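(* Let $n\ge3$ and let $P$ be the $n$-dimensional hypercube, the convex hull of all vectors $(\pm1,\pm1,\ldots,\pm1)\in\mathbb{R}^n$. Then its face lattice $L(P)$ is not isomorphic to the core of any upho lattice.
   Context: The face lattice of a polytope is the poset of its faces (including the empty face and the polytope itself) ordered by inclusion; it is a finite graded lattice with rank of a face $F$ equal to $\dim F+1$. A poset $\mathcal{P}$ is finite type $\mathbb{N}$-graded if it has a minimum $\hat0$, a rank function $\rho$ with $\rho(\hat0)=0$ such that every maximal chain has the form $\hat0=x_0\lessdot x_1\lessdot\cdots$ with $\rho(x_i)=i$, and finitely many elements of each rank. An upho lattice is a finite type $\mathbb{N}$-graded lattice $\mathcal{L}$ with at least two elements such that for every $p\in\mathcal{L}$ the principal filter $\{q\ge p\}$ is isomorphic to $\mathcal{L}$. Its core is the interval $[\hat0,s_1\vee\cdots\vee s_r]$ with $s_1,\ldots,s_r$ the atoms of $\mathcal{L}$. *)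

theory Defs
  imports "HOL-Analysis.Analysis"
begin

definition order_isomorphic :: "'a::order set \<Rightarrow> 'b::order set \<Rightarrow> bool" where
  "order_isomorphic A B \<longleftrightarrow>
     (\<exists>f. bij_betw f A B \<and> (\<forall>x\<in>A. \<forall>y\<in>A. f x \<le> f y \<longleftrightarrow> x \<le> y))"

text \<open>Ordered by inclusion, which is \<open>\<le>\<close> on sets; \<open>(face_of)\<close> admits
  the empty face and the whole polytope.\<close>
definition face_lattice :: "'a::real_vector set \<Rightarrow> 'a set set" where
  "face_lattice P = {F. F face_of P}"

definition covered_by :: "'a::order \<Rightarrow> 'a \<Rightarrow> bool"  (infix "\<lessdot>" 50) where
  "x \<lessdot> y \<longleftrightarrow> x < y \<and> \<not> (\<exists>z. x < z \<and> z < y)"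

text \<open>A maximal chain may be finite or infinite, so it is indexed by an initial segment
  \<open>{..m}\<close> of the natural numbers or by all of them.\<close>
definition rank_function :: "('a::order_bot \<Rightarrow> nat) \<Rightarrow> bool" where
  "rank_function \<rho> \<longleftrightarrow> \<rho> bot = 0 \<and>
     (\<forall>C. pred_on.maxchain (UNIV :: 'a set) (<) C \<longrightarrow>
        (\<exists>(x :: nat \<Rightarrow> 'a) I. (I = UNIV \<or> (\<exists>m. I = {..m})) \<and> C = x ` I \<and> x 0 = bot \<and>
           (\<forall>i. Suc i \<in> I \<longrightarrow> x i \<lessdot> x (Suc i)) \<and> (\<forall>i\<in>I. \<rho> (x i) = i)))"

text \<open>Posets and lattices are represented by whole types; the minimum is supplied by the
  type class.\<close>
definition finite_type_graded :: "'a::order_bot itself \<Rightarrow> bool" where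
  "finite_type_graded _ \<longleftrightarrow>
     (\<exists>\<rho> :: 'a \<Rightarrow> nat. rank_function \<rho> \<and> (\<forall>k. finite {x. \<rho> x = k}))"

definition upho_lattice :: "'a::{lattice,order_bot} itself \<Rightarrow> bool" where
  "upho_lattice T \<longleftrightarrow> finite_type_graded T \<and> (\<exists>x y :: 'a. x \<noteq> y) \<and>
     (\<forall>p :: 'a. order_isomorphic {p..} (UNIV :: 'a set))"

definition atoms :: "'a::order_bot set" where
  "atoms = {s. bot \<lessdot> s}"

text \<open>In an upho lattice \<open>atoms\<close> is finite and nonempty, so \<open>Sup_fin\<close> is its join.\<close>
definition core :: "'a::{lattice,order_bot} set" where
  "core = {bot..Sup_fin atoms}"

end

theory Submission
  imports Defs
begin

text \<open>At a vertex of the cube there are three edges, any two of which span a 2-face covering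
  both. In an upho lattice the filter above that vertex is a copy of the whole lattice, so such a
  configuration also sits above the minimum, and it lies in the core because a common cover of two
  atoms is their join. Hence the cube would have three vertices that are pairwise joined by edges,
  which is impossible as its graph has no triangles.\<close>

section \<open>Triangles over an element of a poset\<close>

text \<open>Covering relative to a subset, because faces, filters and the core are subsets of a
  type: between two faces there may be many sets that are not faces.\<close>

definition covers_in :: "'a::order set \<Rightarrow> 'a \<Rightarrow> 'a \<Rightarrow> bool" where
  "covers_in A x y \<longleftrightarrow> x \<in> A \<and> y \<in> A \<and> x < y \<and> \<not> (\<exists>z\<in>A. x < z \<and> z < y)"

text \<open>Over the empty face of a polytope these are three vertices pairwise joined by edges;
  over a vertex, three edges any two of which lie in a common 2-face.\<close>

definition triangle_over :: "'a::order set \<Rightarrow> 'a \<Rightarrow> bool" where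
  "triangle_over A x \<longleftrightarrow> (\<exists>a b c p q r. a \<noteq> b \<and> b \<noteq> c \<and> a \<noteq> c \<and>
     covers_in A x a \<and> covers_in A x b \<and> covers_in A x c \<and>
     covers_in A a p \<and> covers_in A b p \<and> covers_in A b q \<and> covers_in A c q \<and>
     covers_in A a r \<and> covers_in A c r)"

lemma covers_in_UNIV: "covers_in UNIV x y \<longleftrightarrow> x \<lessdot> y"
  by (auto simp: covers_in_def covered_by_def)

lemma covers_in_atLeast: "covers_in {s..} x y \<longleftrightarrow> s \<le> x \<and> x \<lessdot> y"
  by (auto simp: covers_in_def covered_by_def)

lemma covers_in_atMost: "covers_in {..t} x y \<longleftrightarrow> y \<le> t \<and> x \<lessdot> y"
  by (auto simp: covers_in_def covered_by_def)

text \<open>All elements of the configuration lie above \<open>x\<close>, so covers have to be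
  compared only there. This is what permits passing from the core to a filter.\<close>

lemma triangle_over_mono:
  assumes "\<And>y z. x \<le> y \<Longrightarrow> covers_in A y z \<Longrightarrow> covers_in B y z" "triangle_over A x"
  shows "triangle_over B x"
proof -
  obtain a b c p q r where *: "a \<noteq> b" "b \<noteq> c" "a \<noteq> c"
     "covers_in A x a" "covers_in A x b" "covers_in A x c"
     "covers_in A a p" "covers_in A b p" "covers_in A b q" "covers_in A c q"
     "covers_in A a r" "covers_in A c r"
    using assms(2) unfolding triangle_over_def by blast
  have "x \<le> a" "x \<le> b" "x \<le> c"
    using *(4-6) by (auto simp: covers_in_def)
  then show ?thesis
    unfolding triangle_over_def using *(1-3) *(4-)[THEN assms(1)[rotated]] by blast
qed

lemma covers_in_image:
  assumes "bij_betw f A B" "\<forall>x\<in>A. \<forall>y\<in>A. f x \<le> f y \<longleftrightarrow> x \<le> y" "covers_in A x y"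
  shows "covers_in B (f x) (f y)"
proof -
  have B: "B = f ` A"
    using assms(1) by (simp add: bij_betw_def)
  have less: "f u < f v \<longleftrightarrow> u < v" if "u \<in> A" "v \<in> A" for u v
    using that assms(2) by (simp add: less_le_not_le)
  show ?thesis
    using assms(3) less by (auto simp: covers_in_def B)
qed

lemma triangle_over_image:
  assumes "bij_betw f A B" "\<forall>x\<in>A. \<forall>y\<in>A. f x \<le> f y \<longleftrightarrow> x \<le> y" "triangle_over A x"
  shows "triangle_over B (f x)"
proof -
  obtain a b c p q r where *: "a \<noteq> b" "b \<noteq> c" "a \<noteq> c"
     "covers_in A x a" "covers_in A x b" "covers_in A x c"
     "covers_in A a p" "covers_in A b p" "covers_in A b q" "covers_in A c q"
     "covers_in A a r" "covers_in A c r"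
    using assms(3) unfolding triangle_over_def by blast
  have "a \<in> A" "b \<in> A" "c \<in> A"
    using *(4-6) by (simp_all add: covers_in_def)
  then have "f a \<noteq> f b" "f b \<noteq> f c" "f a \<noteq> f c"
    using *(1-3) assms(1) by (auto simp: bij_betw_def inj_on_def)
  with *(4-)[THEN covers_in_image[OF assms(1,2)]] show ?thesis
    unfolding triangle_over_def by blast
qed

lemma order_isomorphic_sym:
  assumes "order_isomorphic A B"
  shows "order_isomorphic B A"
proof -
  obtain f where f: "bij_betw f A B" "\<forall>x\<in>A. \<forall>y\<in>A. f x \<le> f y \<longleftrightarrow> x \<le> y"
    using assms by (auto simp: order_isomorphic_def)
  have "inv_into A f x \<le> inv_into A f y \<longleftrightarrow> x \<le> y" if "x \<in> B" "y \<in> B" for x y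
    using that f by (metis bij_betw_def bij_betw_inv_into_right inv_into_into)
  with bij_betw_inv_into[OF f(1)] show ?thesis
    unfolding order_isomorphic_def by blast
qed

text \<open>An isomorphism sends the least element to the least element, so the image of the
  configuration sits over the minimum again.\<close>

lemma triangle_over_least_isomorphic:
  assumes "order_isomorphic A B" "triangle_over A x"
    and "\<And>y. y \<in> A \<Longrightarrow> x \<le> y" "z \<in> B" "\<And>y. y \<in> B \<Longrightarrow> z \<le> y"
  shows "triangle_over B z"
proof -
  obtain f where f: "bij_betw f A B" "\<forall>x\<in>A. \<forall>y\<in>A. f x \<le> f y \<longleftrightarrow> x \<le> y"
    using assms(1) by (auto simp: order_isomorphic_def)
  have "x \<in> A"
    using assms(2) by (auto simp: triangle_over_def covers_in_def)
  obtain y where "y \<in> A" "z = f y"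
    using f(1) \<open>z \<in> B\<close> by (auto simp: bij_betw_def)
  with f assms(3,5) \<open>x \<in> A\<close> have "f x = z"
    by (metis bij_betwE order_antisym)
  with triangle_over_image[OF f assms(2)] show ?thesis
    by simp
qed

section \<open>Upho lattices\<close>

text \<open>Rank functions are constrained only along maximal chains. In a maximal chain through an
  atom, the atom stands at position 1, so all atoms belong to the finite level of rank 1. Finiteness
  makes \<open>Sup_fin atoms\<close> an upper bound of the atoms.\<close>

lemma finite_atoms:
  assumes "finite_type_graded TYPE('a::order_bot)"
  shows "finite (atoms :: 'a set)"
proof -
  obtain \<rho> :: "'a \<Rightarrow> nat" where \<rho>: "rank_function \<rho>" "\<And>k. finite {x. \<rho> x = k}"
    using assms by (auto simp: finite_type_graded_def)
  have "\<rho> s = 1" if s: "bot \<lessdot> s" for s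
  proof -
    interpret pred_on "UNIV :: 'a set" "(<)" .
    \<comment> \<open>Zorn's lemma, applied to the chains that contain both \<open>bot\<close> and
      \<open>s\<close>.\<close>
    have "\<exists>M. {bot, s} \<subseteq> M \<and> maxchain M"
    proof -
      have "\<exists>U\<in>{C. chain C \<and> {bot, s} \<subseteq> C}. \<forall>X\<in>K. X \<subseteq> U"
        if "subset.chain {C. chain C \<and> {bot, s} \<subseteq> C} K" for K
      \<comment> \<open>The empty family needs a bound of its own, as its union does not contain
        \<open>{bot, s}\<close>.\<close>
      proof (cases "K = {}")
        case True
        have "chain {bot, s}"
          using s by (auto simp: chain_def covered_by_def)
        with True show ?thesis by auto
      next
        case False
        have "chain (\<Union>K)"
          using that unfolding chain_def subset_chain_def by (smt (verit) UNIV_I Union_iff mem_Collect_eq subset_iff)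
        moreover have "{bot, s} \<subseteq> \<Union>K"
          using that False by (fastforce simp: subset.chain_def)
        ultimately show ?thesis by auto
      qed
      then have "\<exists>M\<in>{C. chain C \<and> {bot, s} \<subseteq> C}. \<forall>X\<in>{C. chain C \<and> {bot, s} \<subseteq> C}. M \<subseteq> X \<longrightarrow> X = M"
        by (rule subset_Zorn)
      then obtain M where M: "M \<in> {C. chain C \<and> {bot, s} \<subseteq> C}"
        and max: "\<forall>X\<in>{C. chain C \<and> {bot, s} \<subseteq> C}. M \<subseteq> X \<longrightarrow> X = M"
        by (rule bexE)
      \<comment> \<open>A chain containing \<open>M\<close> also contains \<open>bot\<close> and
        \<open>s\<close>, so \<open>M\<close> is maximal among all chains.\<close>
      have "\<not> M \<subset> X" if "chain X" for X
        using max[rule_format, of X] M that by auto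
      with M show ?thesis
        unfolding maxchain_def by blast
    qed
    then obtain M x I where M: "{bot, s} \<subseteq> M" "M = x ` I" "I = UNIV \<or> (\<exists>m. I = {..m})" "x 0 = bot"
      "\<And>i. Suc i \<in> I \<Longrightarrow> x i \<lessdot> x (Suc i)" "\<And>i. i \<in> I \<Longrightarrow> \<rho> (x i) = i"
      using \<rho>(1) unfolding rank_function_def by (metis (no_types, lifting))
    obtain i where i: "i \<in> I" "s = x i"
      using M(1,2) by auto
    have "i \<noteq> 0"
      using s i(2) M(4) by (metis covered_by_def less_irrefl)
    have down: "k \<in> I" if "k \<le> i" for k
      using M(3) i(1) that by auto
    \<comment> \<open>The enumeration increases, so \<open>bot < x 1\<close> and
      \<open>x 1 \<le> s\<close>; since \<open>s\<close> covers \<open>bot\<close>, this forces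
      \<open>s = x 1\<close>.\<close>
    have "x k \<le> x i" if "k \<le> i" for k
      using that
    proof (induction rule: inc_induct)
      case (step n)
      then have "x n < x (Suc n)"
        using M(5) down by (auto simp: covered_by_def)
      with step show ?case by simp
    qed simp
    from this[of 1] \<open>i \<noteq> 0\<close> have "x 1 \<le> s"
      using i by simp
    moreover have "bot < x 1"
      using M(4) M(5)[of 0] down[of 1] \<open>i \<noteq> 0\<close> by (auto simp: covered_by_def)
    ultimately have "s = x 1"
      using s by (auto simp: covered_by_def less_le)
    then show ?thesis
      using M(6) down \<open>i \<noteq> 0\<close> by simp
  qed
  then have "atoms \<subseteq> {x. \<rho> x = 1}"
    by (auto simp: atoms_def)
  then show ?thesis
    using \<rho>(2) by (rule finite_subset)
qed

text \<open>The core is a down-set, so its covers are exactly the covers of the lattice between its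
  elements. Hence the triangle can leave the core for the filter of \<open>s\<close>, and its copy
  over \<open>bot\<close> returns to the core once its elements are known to lie below
  \<open>Sup_fin atoms\<close>.\<close>

lemma triangle_over_bot_core:
  assumes "upho_lattice TYPE('a::{lattice,order_bot})" "triangle_over (core :: 'a set) s"
  shows "triangle_over (core :: 'a set) bot"
proof -
  have core: "core = {..Sup_fin (atoms :: 'a set)}"
    by (auto simp: core_def)
  have "triangle_over {s..} s"
    using assms(2) by (rule triangle_over_mono[rotated]) (auto simp: core covers_in_atMost covers_in_atLeast)
  moreover have "order_isomorphic {s..} (UNIV :: 'a set)"
    using assms(1) by (simp add: upho_lattice_def)
  ultimately have "triangle_over (UNIV :: 'a set) bot"
    using triangle_over_least_isomorphic[where A = "{s..}" and B = "UNIV :: 'a set" and x = s] by simp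
  then obtain a b c p q r :: 'a where *: "a \<noteq> b" "b \<noteq> c" "a \<noteq> c"
     "bot \<lessdot> a" "bot \<lessdot> b" "bot \<lessdot> c" "a \<lessdot> p" "b \<lessdot> p" "b \<lessdot> q" "c \<lessdot> q" "a \<lessdot> r" "c \<lessdot> r"
    unfolding triangle_over_def covers_in_UNIV by blast
  have fin: "finite (atoms :: 'a set)"
    using assms(1) by (auto simp: upho_lattice_def intro: finite_atoms)
  have atom: "u \<le> Sup_fin atoms" if "bot \<lessdot> u" for u :: 'a
    using that fin by (auto simp: atoms_def intro: Sup_fin.coboundedI)
  \<comment> \<open>The join of the distinct atoms \<open>u\<close> and \<open>v\<close> lies
    strictly above \<open>u\<close> and weakly below \<open>w\<close>, which covers
    \<open>u\<close>; so \<open>w\<close> is that join.\<close>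
  have "w \<le> Sup_fin atoms" if "bot \<lessdot> u" "bot \<lessdot> v" "u \<noteq> v" "u \<lessdot> w" "v \<lessdot> w" for u v w :: 'a
  proof -
    have "u < sup u v"
      using that(1-3) unfolding covered_by_def
      by (metis order.strict_iff_order sup.absorb_iff1 sup.cobounded1)
    moreover have "sup u v \<le> w"
      using that(4,5) by (simp add: covered_by_def less_imp_le)
    ultimately have "w = sup u v"
      using that(4) unfolding covered_by_def by (metis order.not_eq_order_implies_strict)
    with atom that(1,2) show ?thesis
      by simp
  qed
  with * atom show ?thesis
    unfolding triangle_over_def core covers_in_atMost by blast
qed

section \<open>Faces of the cube\<close>

text \<open>The unit box is the hull of the 0/1 vectors. The affine map \<open>g\<close> carries
  these vectors and this box to the required ones, and taking hulls commutes with affine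
  maps.\<close>

lemma convex_hull_cube:
  "convex hull {v :: real ^ 'n. \<forall>i. v $ i = 1 \<or> v $ i = -1} = {x. \<forall>i. \<bar>x $ i\<bar> \<le> 1}"
    (is "convex hull ?V = ?B")
proof -
  define g :: "real ^ 'n \<Rightarrow> real ^ 'n" where "g = (\<lambda>x. -1 + 2 *\<^sub>R x)"
  have g: "g x $ i = 2 * x $ i - 1" for x i
    by (simp add: g_def)
  have surj: "x = g ((1/2) *\<^sub>R (1 + x))" for x
    by (simp add: vec_eq_iff g field_simps)
  define U :: "(real ^ 'n) set" where "U = {x. \<forall>i. x $ i = 0 \<or> x $ i = 1}"
  have box: "cbox 0 1 = {x :: real ^ 'n. \<forall>i. 0 \<le> x $ i \<and> x $ i \<le> 1}"
    by (auto simp: mem_box_cart)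
  have "{x :: real ^ 'n. \<forall>i\<in>Basis. x \<bullet> i = 0 \<or> x \<bullet> i = 1} = U"
    by (auto simp: U_def Basis_vec_def inner_axis)
  then have hull_U: "convex hull U = cbox 0 1"
    using unit_interval_convex_hull[where 'a = "real ^ 'n"] by (simp flip: Cart_1)
  have "?V = g ` U"
  proof (intro equalityI subsetI)
    fix x assume "x \<in> ?V"
    then have "(1/2) *\<^sub>R (1 + x) \<in> U"
      by (auto simp: U_def)
    with surj show "x \<in> g ` U" by blast
  next
    fix x assume "x \<in> g ` U"
    then show "x \<in> ?V" by (fastforce simp: U_def g)
  qed
  moreover have "?B = g ` cbox 0 1"
  proof (intro equalityI subsetI)
    fix x assume "x \<in> ?B"
    then have "\<bar>x $ i\<bar> \<le> 1" for i
      by simp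
    then have "0 \<le> 1 + x $ i" "x $ i \<le> 1" for i
      by (smt (verit))+
    then have "(1/2) *\<^sub>R (1 + x) \<in> cbox 0 1"
      by (simp add: box)
    with surj show "x \<in> g ` cbox 0 1" by blast
  next
    fix x assume "x \<in> g ` cbox 0 1"
    then obtain u where "x = g u" "\<And>i. 0 \<le> u $ i" "\<And>i. u $ i \<le> 1"
      by (auto simp: box)
    then show "x \<in> ?B" by (simp add: g abs_le_iff)
  qed
  ultimately show ?thesis
    by (simp only: g_def convex_hull_affinity hull_U)
qed

definition cube :: "(real ^ 'n) set" where
  "cube = {x. \<forall>i. \<bar>x $ i\<bar> \<le> 1}"

lemma convex_cube: "convex cube"
  unfolding cube_def convex_hull_cube[symmetric] by (rule convex_convex_hull)

lemma compact_cube: "compact (cube :: (real ^ 'n) set)"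
proof -
  have "cube = cbox (-1) (1 :: real ^ 'n)"
    by (auto simp: cube_def mem_box_cart abs_le_iff minus_le_iff)
  then show ?thesis
    by (metis compact_cbox)
qed

section \<open>Faces through the vertex \<open>1\<close>\<close>

text \<open>The coordinates in \<open>S\<close> are free and the others are fixed at 1, so this is a
  face of dimension \<open>card S\<close> through the all-ones vertex.\<close>

definition cube_face :: "'n set \<Rightarrow> (real ^ 'n) set" where
  "cube_face S = {x \<in> cube. \<forall>k. k \<notin> S \<longrightarrow> x $ k = 1}"

text \<open>The hyperplanes at 1 and at -1 support the cube from opposite sides. Both signs matter,
  as arbitrary vertices are treated below.\<close>

lemma facet_face_of_cube:
  fixes k :: "'n::finite"
  assumes "\<bar>t\<bar> = 1"
  shows "{x \<in> cube :: (real ^ 'n) set. x $ k = t} face_of cube"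
proof (cases "t = 1")
  case True
  have "cube \<inter> {x :: real ^ 'n. axis k 1 \<bullet> x = 1} face_of cube"
    by (rule face_of_Int_supporting_hyperplane_le[OF convex_cube])
       (auto simp: cube_def inner_axis' abs_le_iff)
  with True show ?thesis by (simp add: inner_axis' Int_def)
next
  case False
  have "cube \<inter> {x :: real ^ 'n. axis k 1 \<bullet> x = -1} face_of cube"
    by (rule face_of_Int_supporting_hyperplane_ge[OF convex_cube])
       (auto simp: cube_def inner_axis' abs_le_iff minus_le_iff)
  moreover have "t = -1" using False assms by linarith
  ultimately show ?thesis by (simp add: inner_axis' Int_def)
qed

lemma cube_face_face_of: "cube_face S face_of cube"
proof -
  have "cube_face S = cube \<inter> (\<Inter>k\<in>-S. {x \<in> cube. x $ k = 1})"
    by (auto simp: cube_face_def)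
  \<comment> \<open>Inserting \<open>cube\<close> keeps the family nonempty when \<open>S\<close>
    contains every coordinate.\<close>
  also have "\<dots> = \<Inter> (insert cube ((\<lambda>k. {x \<in> cube. x $ k = 1}) ` (-S)))"
    by simp
  also have "\<dots> face_of cube"
    by (rule face_of_Inter) (auto intro: facet_face_of_cube face_of_refl convex_cube)
  finally show ?thesis .
qed

lemma cube_face_empty: "cube_face {} = {1}"
  by (auto simp: cube_face_def cube_def vec_eq_iff)

text \<open>A face \<open>G\<close> strictly above the smaller face contains a relative interior
  point \<open>m\<close> of the larger one. Every \<open>z\<close> of the larger face is an endpoint
  of a segment in the cube with \<open>m\<close> inside, which puts \<open>z\<close> into
  \<open>G\<close>.\<close>

lemma cube_face_insert_covers:
  fixes i :: "'n::finite"
  assumes "i \<notin> S"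
  shows "covers_in (face_lattice cube) (cube_face S) (cube_face (insert i S))"
proof -
  define w :: "real ^ 'n" where "w = (\<chi> k. if k = i then -1 else 1)"
  have "w \<in> cube_face (insert i S)" "w \<notin> cube_face S"
    using assms by (auto simp: cube_face_def cube_def w_def)
  then have "cube_face S \<subset> cube_face (insert i S)"
    by (auto simp: cube_face_def)
  moreover have "cube_face (insert i S) \<subseteq> G"
    if G: "G face_of cube" and less: "cube_face S \<subset> G" "G \<subseteq> cube_face (insert i S)" for G
  proof
    fix z assume z: "z \<in> cube_face (insert i S)"
    from less obtain y where y: "y \<in> G" "y \<notin> cube_face S" by blast
    have yc: "\<bar>y $ k\<bar> \<le> 1" "k \<notin> insert i S \<Longrightarrow> y $ k = 1" for k
      using y less(2) by (auto simp: cube_face_def cube_def)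
    have yi: "y $ i < 1"
    proof -
      have "y \<in> cube" using y less(2) by (auto simp: cube_face_def)
      with y(2) yc(2) have "y $ i \<noteq> 1" by (auto simp: cube_face_def) metis
      with yc(1)[of i] show ?thesis by linarith
    qed
    \<comment> \<open>A point of \<open>G\<close> in the relative interior of the larger face.\<close>
    define u :: "real ^ 'n" where "u = (\<chi> k. if k \<in> S then 0 else 1)"
    define m where "m = (1/2) *\<^sub>R y + (1/2) *\<^sub>R u"
    have "u \<in> cube_face S"
      by (auto simp: u_def cube_face_def cube_def)
    then have "m \<in> G"
      unfolding m_def using less(1) y(1) face_of_imp_convex[OF G]
      by (intro convexD) auto
    have m: "m $ k = (y $ k + u $ k) / 2" for k
      by (simp add: m_def field_simps)
    \<comment> \<open>A margin for the free coordinates of \<open>m\<close>: those in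
      \<open>S\<close> have absolute value at most 1/2 because \<open>u\<close> vanishes there, and
      \<open>y $ i < 1\<close> handles coordinate \<open>i\<close>.\<close>
    define \<delta> where "\<delta> = min (1/2) (1 - \<bar>m $ i\<bar>)"
    have \<delta>: "0 < \<delta>"
      using yi yc(1)[of i] assms by (auto simp: \<delta>_def m u_def)
    have md: "\<bar>m $ k\<bar> \<le> 1 - \<delta>" if "k \<in> insert i S" for k
    proof (cases "k = i")
      case False
      then have "\<bar>m $ k\<bar> \<le> 1/2"
        using that yc(1)[of k] by (simp add: m u_def)
      then show ?thesis by (simp add: \<delta>_def min_def)
    qed (simp add: \<delta>_def min_def)
    \<comment> \<open>The segment from \<open>z\<close> to \<open>m\<close> is prolonged beyond
      \<open>m\<close>. Free coordinates of \<open>m - z\<close> are at most 2 in absolute value, so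
      the factor \<open>\<delta>/2\<close> moves each by at most the margin.\<close>
    define z' where "z' = m + (\<delta>/2) *\<^sub>R (m - z)"
    have zc: "z \<in> cube" using z by (simp add: cube_face_def)
    have "z' \<in> cube"
      unfolding cube_def mem_Collect_eq
    proof
      fix k
      show "\<bar>z' $ k\<bar> \<le> 1"
      proof (cases "k \<in> insert i S")
        case True
        have "\<bar>m $ k - z $ k\<bar> \<le> 2"
          using md[OF True] \<delta> zc by (auto simp: cube_def dest!: spec[of _ k])
        then have "\<bar>(\<delta>/2) * (m $ k - z $ k)\<bar> \<le> \<delta>"
          using \<delta> by (simp add: abs_mult mult_left_le)
        with md[OF True] show ?thesis
          by (simp add: z'_def)
      next
        case False
        then have "m $ k = 1" "z $ k = 1"
          using yc(2) z by (auto simp: m u_def cube_face_def)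
        then show ?thesis by (simp add: z'_def)
      qed
    qed
    show "z \<in> G"
    proof (cases "z = m")
      case False
      \<comment> \<open>Solves \<open>m = (1 - t) *\<^sub>R z' + t *\<^sub>R z\<close>.\<close>
      define t where "t = (\<delta>/2) / (1 + \<delta>/2)"
      have t: "0 < t" "t < 1" using \<delta> by (auto simp: t_def field_simps)
      have "(1 - t) * (1 + \<delta>/2) = 1" "(1 - t) * (\<delta>/2) = t"
        using \<delta> by (auto simp: t_def field_simps)
      then have "(1 - t) *\<^sub>R z' + t *\<^sub>R z = m"
        unfolding z'_def by (simp add: vec_eq_iff) (simp add: algebra_simps, algebra)
      moreover have "z' \<noteq> z"
      proof
        assume "z' = z"
        then have "(1 + \<delta>/2) *\<^sub>R (m - z) = 0"
          by (simp add: z'_def algebra_simps)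
        with \<delta> False show False by simp
      qed
      ultimately have "m \<in> open_segment z' z"
        using t unfolding in_segment by metis
      with G \<open>m \<in> G\<close> \<open>z' \<in> cube\<close> zc show ?thesis
        unfolding face_of_def by blast
    qed (use \<open>m \<in> G\<close> in simp)
  qed
  ultimately show ?thesis
    using cube_face_face_of unfolding covers_in_def face_lattice_def by blast
qed

lemma triangle_over_vertex_cube:
  assumes "CARD('n::finite) \<ge> 3"
  shows "triangle_over (face_lattice (cube :: (real ^ 'n) set)) {1}"
proof -
  obtain T :: "'n set" where "card T = 3"
    using assms obtain_subset_with_card_n by metis
  then obtain i j k :: 'n where ijk: "i \<noteq> j" "j \<noteq> k" "i \<noteq> k"
    by (auto simp: card_3_iff)
  have cov: "covers_in (face_lattice cube) (cube_face {a}) (cube_face {a, b})"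
            "covers_in (face_lattice cube) (cube_face {b}) (cube_face {a, b})"
    if "a \<noteq> b" for a b :: 'n
    using cube_face_insert_covers[of b "{a}"] cube_face_insert_covers[of a "{b}"] that
    by (auto simp: insert_commute)
  have ne: "cube_face {a} \<noteq> cube_face {b}" if "a \<noteq> b" for a b :: 'n
  proof -
    have "(\<chi> k. if k = a then -1 else 1) \<in> cube_face {a} - cube_face {b}"
      using that by (auto simp: cube_face_def cube_def)
    then show ?thesis by blast
  qed
  have "covers_in (face_lattice cube) {1} (cube_face {a})" for a :: 'n
    using cube_face_insert_covers[of a "{}"] by (simp add: cube_face_empty)
  with cov ne ijk show ?thesis
    unfolding triangle_over_def
    by (intro exI[of _ "cube_face {i}"] exI[of _ "cube_face {j}"] exI[of _ "cube_face {k}"]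
        exI[of _ "cube_face {i, j}"] exI[of _ "cube_face {j, k}"] exI[of _ "cube_face {i, k}"]) simp
qed

section \<open>Vertices and edges of the cube\<close>

text \<open>A nonempty compact convex face has an extreme point, which is itself a face of the cube,
  so minimality leaves only that point. Extreme points of a hull are among its generators.\<close>

lemma atom_face_lattice_cube:
  assumes "covers_in (face_lattice cube) {} V"
  obtains v where "V = {v}" "\<And>i. \<bar>v $ i\<bar> = 1"
proof -
  have V: "V face_of cube" "V \<noteq> {}"
    using assms by (auto simp: covers_in_def face_lattice_def)
  have "compact V" "convex V"
    using V(1) face_of_imp_compact[OF convex_cube compact_cube] face_of_imp_convex by auto
  then obtain v where "v extreme_point_of V"
    using V(2) extreme_point_exists_convex by blast
  then have v: "{v} face_of V"
    by (simp add: face_of_singleton)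
  then have vc: "{v} face_of cube"
    using V(1) face_of_trans by blast
  have "{v} \<subseteq> V"
    using v face_of_imp_subset by blast
  then have "V = {v}"
    using assms vc by (auto simp: covers_in_def face_lattice_def)
  moreover have "v \<in> {v. \<forall>i. v $ i = 1 \<or> v $ i = -1}"
    using vc unfolding face_of_singleton cube_def convex_hull_cube[symmetric]
    by (rule extreme_point_of_convex_hull)
  then have "\<bar>v $ i\<bar> = 1" for i
    by (auto dest!: spec[of _ i])
  ultimately show thesis
    using that by blast
qed

text \<open>If \<open>v\<close> and \<open>w\<close> differed in two coordinates, exchanging their
  entries at one of them would give two further vertices with the same midpoint. These would lie in
  \<open>G\<close> too, which is too many for an edge.\<close>

lemma vertices_of_edge_differ_once:
  assumes "covers_in (face_lattice cube) {v} G" "covers_in (face_lattice cube) {w} G"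
    and "\<And>i. \<bar>v $ i\<bar> = 1" "\<And>i. \<bar>w $ i\<bar> = 1" "v $ i \<noteq> w $ i" "v $ j \<noteq> w $ j"
  shows "i = j"
proof (rule ccontr)
  assume "i \<noteq> j"
  have G: "G face_of cube" and vw: "v \<in> G" "w \<in> G"
    using assms(1,2) by (auto simp: covers_in_def face_lattice_def)
  \<comment> \<open>This face contains \<open>v\<close> but not \<open>w\<close>, so it is strictly
    smaller than \<open>G\<close> and must be \<open>{v}\<close>.\<close>
  define H where "H = G \<inter> {x \<in> cube. x $ i = v $ i}"
  have "H face_of cube"
    unfolding H_def by (intro face_of_Int G facet_face_of_cube assms(3))
  moreover have "v \<in> H" "w \<notin> H"
    using vw assms(5) G face_of_imp_subset by (auto simp: H_def)
  moreover have "H \<subseteq> G"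
    by (auto simp: H_def)
  ultimately have H: "H = {v}"
    using assms(1) vw unfolding covers_in_def face_lattice_def by blast
  define a b where "a = (\<chi> k. if k = j then w $ k else v $ k)"
    and "b = (\<chi> k. if k = j then v $ k else w $ k)"
  have ab: "a \<in> cube" "b \<in> cube"
    using assms(3,4) by (auto simp: a_def b_def cube_def)
  have "a \<noteq> b"
    using \<open>i \<noteq> j\<close> assms(5) by (auto simp: a_def b_def vec_eq_iff)
  moreover have "midpoint v w = midpoint a b"
    by (auto simp: midpoint_def a_def b_def vec_eq_iff)
  ultimately have "midpoint v w \<in> open_segment a b"
    by (simp add: midpoint_in_open_segment)
  moreover have "midpoint v w \<in> G"
    using vw face_of_imp_convex[OF G] by (auto simp: midpoint_def scaleR_add_right intro: convexD)
  ultimately have "a \<in> G"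
    using G ab unfolding face_of_def by blast
  \<comment> \<open>The exchange at \<open>j\<close> leaves coordinate \<open>i\<close> of
    \<open>v\<close> unchanged.\<close>
  with ab have "a \<in> H"
    using \<open>i \<noteq> j\<close> by (simp add: H_def a_def)
  then have "a $ j = v $ j"
    by (simp add: H)
  with assms(6) show False
    by (simp add: a_def)
qed

text \<open>At the only coordinate \<open>i\<close> where \<open>a\<close> and \<open>b\<close>
  differ, \<open>c\<close> agrees with one of them and differs from the other. So a second side has
  direction \<open>i\<close> as well, and the endpoints of the third side then agree
  everywhere.\<close>

lemma not_triangle_over_empty_cube: "\<not> triangle_over (face_lattice cube) {}"
proof
  assume "triangle_over (face_lattice cube) ({} :: (real ^ 'n) set)"
  then obtain A B C P Q R :: "(real ^ 'n) set" where *: "A \<noteq> B" "B \<noteq> C" "A \<noteq> C"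
     "covers_in (face_lattice cube) {} A" "covers_in (face_lattice cube) {} B"
     "covers_in (face_lattice cube) {} C"
     "covers_in (face_lattice cube) A P" "covers_in (face_lattice cube) B P"
     "covers_in (face_lattice cube) B Q" "covers_in (face_lattice cube) C Q"
     "covers_in (face_lattice cube) A R" "covers_in (face_lattice cube) C R"
    unfolding triangle_over_def by blast
  obtain a b c where A: "A = {a}" "\<And>i. \<bar>a $ i\<bar> = 1" and B: "B = {b}" "\<And>i. \<bar>b $ i\<bar> = 1"
    and C: "C = {c}" "\<And>i. \<bar>c $ i\<bar> = 1"
    using *(4-6) atom_face_lattice_cube by metis
  obtain i j k where i: "a $ i \<noteq> b $ i" and j: "b $ j \<noteq> c $ j" and k: "a $ k \<noteq> c $ k"
    using *(1-3) A(1) B(1) C(1) by (auto simp: vec_eq_iff)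
  note ab = vertices_of_edge_differ_once[OF *(7,8)[unfolded A B] A(2) B(2)]
  note bc = vertices_of_edge_differ_once[OF *(9,10)[unfolded B C] B(2) C(2)]
  note ac = vertices_of_edge_differ_once[OF *(11,12)[unfolded A C] A(2) C(2)]
  have two_values: "a $ i = c $ i \<or> b $ i = c $ i"
    using i A(2)[of i] B(2)[of i] C(2)[of i] by linarith
  show False
    using i j k two_values ab bc ac by metis
qed

theorem theorem5p13:
  fixes P :: "(real ^ 'n) set"
  assumes "CARD('n) \<ge> 3"
    and "P = convex hull {v. \<forall>i. v $ i = 1 \<or> v $ i = -1}"
    and "upho_lattice TYPE('a::{lattice,order_bot})"
  shows "\<not> order_isomorphic (face_lattice P) (core :: 'a set)"
proof
  assume iso: "order_isomorphic (face_lattice P) (core :: 'a set)"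
  have P: "P = cube"
    using assms(2) by (simp add: convex_hull_cube cube_def)
  obtain f where f: "bij_betw f (face_lattice P) (core :: 'a set)"
    "\<forall>x\<in>face_lattice P. \<forall>y\<in>face_lattice P. f x \<le> f y \<longleftrightarrow> x \<le> y"
    using iso by (auto simp: order_isomorphic_def)
  have "triangle_over core (f {1})"
    using triangle_over_image[OF f] triangle_over_vertex_cube[OF assms(1)] P by blast
  then have "triangle_over (core :: 'a set) bot"
    by (rule triangle_over_bot_core[OF assms(3)])
  \<comment> \<open>Back along the inverse isomorphism, which sends \<open>bot\<close> to the least
    face \<open>{}\<close>.\<close>
  then have "triangle_over (face_lattice P) {}"
    by (intro triangle_over_least_isomorphic[OF order_isomorphic_sym[OF iso]])
       (auto simp: face_lattice_def)
  then show False
    using not_triangle_over_empty_cube P by blast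
qed

end
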